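(* Let $(X,+)$ be an abelian group with a summation system $\Sigma$ satisfying addition functoriality and negation functoriality. Given a subgroup $S\le X$, the quotient relation $\overline\Sigma$ is a summation system on $\overline X=X/S$ (i.e., it is a function, not merely a relation) if and only if $S$ is $\Sigma$-closed.
   Context: A summation system on a set $X$ is a partial function $\Sigma\colon\bigcup_I X^I\to X$, the union running over all sets $I$; a family is summable if it lies in $\mathrm{dom}(\Sigma)$. For $\underline a\in X^I$, $\underline b\in X^J$, the family $\underline a+\underline b\in X^{I\cup J}$ is the componentwise sum after extending both families to $I\cup J$ by zeros; $-\underline a=(-a_i)_{i\in I}$. Addition functoriality: if $\underline a,\underline b$ are summable, then $\underline a+\underline b$ is summable and $\Sigma[\underline a+\underline b]=\Sigma\underline a+\Sigma\underline b$. Negation functoriality: if $\underline a$ is summable, then $-\underline a$ is summable and $\Sigma[-\underline a]=-\Sigma\underline a$. Bars denote cosets in $\overline X=X/S$. The quotient relation is $$\overline\Sigma=\Big\{\big((\overline{a_i})_{i\in I},\overline x\big)\in\bigcup_I\overline X^I\times\overline X:\ (a_i)_{i\in I}\text{ is }\Sigma\text{-summable with sum }x\Big\}.$$ A subset $S\subseteq X$ is $\Sigma$-closed if whenever all members of a summable family belong to $S$, the sum belongs to $S$. *)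

theory Defs
  imports "HOL-Algebra.Coset"
begin

text \<open>
  A family \<open>(a\<^sub>i)\<^sub>i\<^sub>\<in>\<^sub>I\<close> is a partial map \<open>a :: 'i \<rightharpoonup> 'x\<close> with \<open>dom a = I\<close>, so two families
  are equal iff they have the same index set and the same members; \<open>ran a\<close> is the set of members.
  The index sets are all the subsets of the type \<open>'i\<close>, which is arbitrary.

  Abelian groups are in the multiplicative notation of \<open>comm_group\<close>: \<open>\<otimes>\<close>, \<open>\<one>\<close>, \<open>inv\<close>
  stand for \<open>+\<close>, \<open>0\<close>, \<open>-\<close>.
\<close>

definition families :: "'x set \<Rightarrow> ('i \<rightharpoonup> 'x) set"
  where "families A = {a. ran a \<subseteq> A}"

text \<open>Partial functions are taken to be single-valued relations (graphs), so that being a summation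
  system is a property of an arbitrary relation between families and elements.\<close>

definition summation_system :: "'x set \<Rightarrow> (('i \<rightharpoonup> 'x) \<times> 'x) set \<Rightarrow> bool"
  where "summation_system A \<Phi> \<longleftrightarrow> \<Phi> \<subseteq> families A \<times> A \<and> single_valued \<Phi>"

definition summable_fam :: "(('i \<rightharpoonup> 'x) \<times> 'x) set \<Rightarrow> ('i \<rightharpoonup> 'x) \<Rightarrow> bool"
  where "summable_fam \<Phi> a \<longleftrightarrow> a \<in> Domain \<Phi>"

text \<open>Only meaningful when \<open>\<Phi>\<close> is single-valued and \<open>a\<close> is summable.\<close>

definition fam_sum :: "(('i \<rightharpoonup> 'x) \<times> 'x) set \<Rightarrow> ('i \<rightharpoonup> 'x) \<Rightarrow> 'x"
  where "fam_sum \<Phi> a = (THE x. (a, x) \<in> \<Phi>)"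

definition zero_ext :: "('x, 'm) monoid_scheme \<Rightarrow> ('i \<rightharpoonup> 'x) \<Rightarrow> 'i \<Rightarrow> 'x"
  where "zero_ext X a i = (case a i of None \<Rightarrow> \<one>\<^bsub>X\<^esub> | Some x \<Rightarrow> x)"

definition fam_add :: "('x, 'm) monoid_scheme \<Rightarrow> ('i \<rightharpoonup> 'x) \<Rightarrow> ('i \<rightharpoonup> 'x) \<Rightarrow> ('i \<rightharpoonup> 'x)"
  where "fam_add X a b =
    (\<lambda>i. if i \<in> dom a \<union> dom b then Some (zero_ext X a i \<otimes>\<^bsub>X\<^esub> zero_ext X b i) else None)"

definition fam_neg :: "('x, 'm) monoid_scheme \<Rightarrow> ('i \<rightharpoonup> 'x) \<Rightarrow> ('i \<rightharpoonup> 'x)"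
  where "fam_neg X a = map_option (\<lambda>x. inv\<^bsub>X\<^esub> x) \<circ> a"

definition addition_functorial :: "('x, 'm) monoid_scheme \<Rightarrow> (('i \<rightharpoonup> 'x) \<times> 'x) set \<Rightarrow> bool"
  where "addition_functorial X \<Phi> \<longleftrightarrow>
    (\<forall>a b. summable_fam \<Phi> a \<and> summable_fam \<Phi> b \<longrightarrow>
      summable_fam \<Phi> (fam_add X a b) \<and>
      fam_sum \<Phi> (fam_add X a b) = fam_sum \<Phi> a \<otimes>\<^bsub>X\<^esub> fam_sum \<Phi> b)"

definition negation_functorial :: "('x, 'm) monoid_scheme \<Rightarrow> (('i \<rightharpoonup> 'x) \<times> 'x) set \<Rightarrow> bool"
  where "negation_functorial X \<Phi> \<longleftrightarrow>
    (\<forall>a. summable_fam \<Phi> a \<longrightarrow>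
      summable_fam \<Phi> (fam_neg X a) \<and>
      fam_sum \<Phi> (fam_neg X a) = inv\<^bsub>X\<^esub> (fam_sum \<Phi> a))"

definition sum_closed :: "(('i \<rightharpoonup> 'x) \<times> 'x) set \<Rightarrow> 'x set \<Rightarrow> bool"
  where "sum_closed \<Phi> S \<longleftrightarrow>
    (\<forall>a. summable_fam \<Phi> a \<and> ran a \<subseteq> S \<longrightarrow> fam_sum \<Phi> a \<in> S)"

text \<open>\<open>S #>\<^bsub>X\<^esub> x\<close> is the coset of \<open>x\<close>, an element of \<open>carrier (X Mod S)\<close>.\<close>

definition quotient_relation ::
    "('x, 'm) monoid_scheme \<Rightarrow> 'x set \<Rightarrow> (('i \<rightharpoonup> 'x) \<times> 'x) set \<Rightarrow> (('i \<rightharpoonup> 'x set) \<times> 'x set) set"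
  where "quotient_relation X S \<Phi> =
    {(map_option (\<lambda>y. S #>\<^bsub>X\<^esub> y) \<circ> a, S #>\<^bsub>X\<^esub> x) | a x.
      summable_fam \<Phi> a \<and> fam_sum \<Phi> a = x}"

end

(* Two families have the same image in X/S iff their difference takes its values in S, and by
   functoriality the difference sums to the difference of the sums; so a closed S makes the
   quotient sum well defined. Conversely, a summable family a with values in S has the same image
   as the zero family a + (-a) with the same index set, whose sum is 0. *)
theory Submission
  imports Defs
begin

lemma fam_sum_eq:
  assumes "single_valued \<Phi>" "(a, x) \<in> \<Phi>"
  shows "fam_sum \<Phi> a = x"
  unfolding fam_sum_def using assms by (auto dest: single_valuedD)

lemma summable_famD:
  assumes "summation_system A \<Phi>" "summable_fam \<Phi> a"
  shows "ran a \<subseteq> A" "fam_sum \<Phi> a \<in> A"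
  using assms fam_sum_eq[of \<Phi> a]
  by (auto simp: summation_system_def summable_fam_def families_def)

lemma fam_diff_summable:
  assumes "addition_functorial X \<Phi>" "negation_functorial X \<Phi>"
    and "summable_fam \<Phi> a" "summable_fam \<Phi> b"
  shows "summable_fam \<Phi> (fam_add X a (fam_neg X b))"
    and "fam_sum \<Phi> (fam_add X a (fam_neg X b)) =
      fam_sum \<Phi> a \<otimes>\<^bsub>X\<^esub> inv\<^bsub>X\<^esub> (fam_sum \<Phi> b)"
  using assms unfolding addition_functorial_def negation_functorial_def by auto

lemma dom_fam_neg [simp]: "dom (fam_neg X a) = dom a"
  by (auto simp: fam_neg_def)

text \<open>Over a common index set the default zero of \<open>zero_ext\<close> never enters, so the
  difference is formed member by member. The value \<open>the (b i)\<close> is read only where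
  \<open>a i\<close>, and hence \<open>b i\<close>, is defined.\<close>

lemma fam_diff_apply:
  assumes "dom a = dom b"
  shows "fam_add X a (fam_neg X b) i =
    (case a i of None \<Rightarrow> None | Some x \<Rightarrow> Some (x \<otimes>\<^bsub>X\<^esub> inv\<^bsub>X\<^esub> (the (b i))))"
  using assms[THEN eq_refl, THEN subsetD, of i] assms[symmetric, THEN eq_refl, THEN subsetD, of i]
  by (auto simp: fam_add_def zero_ext_def fam_neg_def dom_def split: option.splits)

text \<open>Right multiplication by \<open>inv y\<close> turns the equality of cosets into
  \<open>H #> (x \<otimes> inv y) = H\<close>, which is membership in \<open>H\<close>.\<close>

lemma (in group) rcos_eq_iff:
  assumes "subgroup H G" "x \<in> carrier G" "y \<in> carrier G"
  shows "H #> x = H #> y \<longleftrightarrow> x \<otimes> inv y \<in> H"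
  using assms
  by (metis coset_mult_inv1 coset_mult_inv2 coset_join1 coset_join2 inv_closed m_closed
      subgroup.subset)

theorem proposition11p2:
  fixes X :: "('x, 'm) monoid_scheme"
    and \<Phi> :: "(('i \<rightharpoonup> 'x) \<times> 'x) set"
    and S :: "'x set"
  assumes "comm_group X"
    and "summation_system (carrier X) \<Phi>"
    and "addition_functorial X \<Phi>"
    and "negation_functorial X \<Phi>"
    and "subgroup S X"
  shows "summation_system (carrier (X Mod S)) (quotient_relation X S \<Phi>) \<longleftrightarrow> sum_closed \<Phi> S"
proof -
  interpret comm_group X by fact
  let ?coset = "\<lambda>y. S #>\<^bsub>X\<^esub> y"
  note ranD = summable_famD(1)[OF assms(2)] and sumD = summable_famD(2)[OF assms(2)]
  note diff = fam_diff_summable[OF assms(3,4)]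
  note coset_eq = rcos_eq_iff[OF assms(5)]
  \<comment> \<open>This half of being a summation system holds for every subgroup; only
    single-valuedness is at stake in both directions below.\<close>
  have cosets: "quotient_relation X S \<Phi> \<subseteq> families (carrier (X Mod S)) \<times> carrier (X Mod S)"
    using ranD sumD
    by (fastforce simp: quotient_relation_def families_def FactGroup_def RCOSETS_def ran_def)
  show ?thesis
  proof
    assume "summation_system (carrier (X Mod S)) (quotient_relation X S \<Phi>)"
    then have sv: "single_valued (quotient_relation X S \<Phi>)"
      by (simp add: summation_system_def)
    show "sum_closed \<Phi> S"
      unfolding sum_closed_def
    proof (intro allI impI, elim conjE)
      fix a :: "'i \<rightharpoonup> 'x"
      assume a: "summable_fam \<Phi> a" and S: "ran a \<subseteq> S"
      let ?z = "fam_add X a (fam_neg X a)"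
      have mem: "y \<in> S" "y \<in> carrier X" if "a i = Some y" for i y
        using that S ranD[OF a] by (auto simp: ran_def)
      \<comment> \<open>Each member of \<open>?z\<close> is \<open>y \<otimes> inv y\<close>, the
        identity, so by \<open>coset_eq\<close> the claim at each index reduces to
        \<open>inv y\<close> lying in \<open>S\<close>.\<close>
      have "map_option ?coset \<circ> ?z = map_option ?coset \<circ> a"
        using mem subgroup.m_inv_closed[OF assms(5)]
        by (auto simp: fun_eq_iff fam_diff_apply coset_eq split: option.splits)
      moreover have "fam_sum \<Phi> ?z = \<one>\<^bsub>X\<^esub>"
        using diff(2)[OF a a] sumD[OF a] by simp
      ultimately have "(map_option ?coset \<circ> a, ?coset \<one>\<^bsub>X\<^esub>) \<in> quotient_relation X S \<Phi>"
        unfolding quotient_relation_def using diff(1)[OF a a] by (smt (verit) mem_Collect_eq)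
      moreover have "(map_option ?coset \<circ> a, ?coset (fam_sum \<Phi> a)) \<in> quotient_relation X S \<Phi>"
        unfolding quotient_relation_def using a by blast
      ultimately have "?coset (fam_sum \<Phi> a) = ?coset \<one>\<^bsub>X\<^esub>"
        using sv by (auto dest: single_valuedD)
      then show "fam_sum \<Phi> a \<in> S"
        using sumD[OF a] by (simp add: coset_eq)
    qed
  next
    assume closed: "sum_closed \<Phi> S"
    have "?coset (fam_sum \<Phi> a) = ?coset (fam_sum \<Phi> b)"
      if a: "summable_fam \<Phi> a" and b: "summable_fam \<Phi> b"
        and eq: "map_option ?coset \<circ> a = map_option ?coset \<circ> b" for a b
    proof -
      have eq_at: "map_option ?coset (a i) = map_option ?coset (b i)" for i
        using eq by (simp add: fun_eq_iff)
      \<comment> \<open>\<open>map_option\<close> sends only \<open>None\<close> to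
        \<open>None\<close>, so the coset families still show where \<open>a\<close> and
        \<open>b\<close> are defined.\<close>
      have dom: "dom a = dom b"
        using eq_at by (metis (no_types, lifting) domIff option.map_disc_iff subsetI subset_antisym)
      have "x \<otimes>\<^bsub>X\<^esub> inv\<^bsub>X\<^esub> (the (b i)) \<in> S" if x: "a i = Some x" for i x
      proof -
        obtain y where y: "b i = Some y" using eq_at[of i] x by (cases "b i") auto
        have "x \<in> carrier X" "y \<in> carrier X"
          using x y ranD[OF a] ranD[OF b] by (auto simp: ran_def)
        then show ?thesis
          using eq_at[of i] x y coset_eq[of x y] by simp
      qed
      then have "ran (fam_add X a (fam_neg X b)) \<subseteq> S"
        by (auto simp: ran_def fam_diff_apply[OF dom] split: option.splits)
      then have "fam_sum \<Phi> a \<otimes>\<^bsub>X\<^esub> inv\<^bsub>X\<^esub> (fam_sum \<Phi> b) \<in> S"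
        using closed diff[OF a b] unfolding sum_closed_def by metis
      then show ?thesis
        using sumD[OF a] sumD[OF b] by (simp add: coset_eq)
    qed
    \<comment> \<open>Two pairs with the same first component come from summable families
      \<open>a\<close> and \<open>b\<close> with the same coset family, which is the case just
      settled.\<close>
    then have "single_valued (quotient_relation X S \<Phi>)"
      unfolding single_valued_def quotient_relation_def by blast
    then show "summation_system (carrier (X Mod S)) (quotient_relation X S \<Phi>)"
      using cosets by (simp add: summation_system_def)
  qed
qed

end
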